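(* Let $c\in\mathbb{C}\setminus\{0\}$ and let $\xi=\lambda^{-1}\begin{pmatrix}0&1\\ c z^{-1}&0\end{pmatrix}dz$. Let $L$ be any solution of $dL=L\,\xi$ (with values in $\Lambda \mathrm{SL}_2\mathbb{C}_\sigma$, defined on the universal cover of $\mathbb{C}\setminus\{0\}$). Then the isotropy group of $L$ relative to the dressing action is $\{\pm I\}$, where $I$ is the identity matrix.
   Context: $\Lambda \mathrm{SL}_2\mathbb{C}_\sigma$ is the twisted loop group of smooth maps from the unit circle $\mathbb{S}^1=\{\lambda\in\mathbb{C}:|\lambda|=1\}$ to $\mathrm{SL}_2\mathbb{C}$ whose diagonal entries are even functions of $\lambda$ and whose off-diagonal entries are odd functions of $\lambda$. $\Lambda_+\mathrm{SL}_2\mathbb{C}_\sigma$ is the subgroup of those loops that extend smoothly to an $\mathrm{SL}_2\mathbb{C}$-valued map on the closed unit disk, holomorphic in the interior. A solution $L=L(z,\lambda)$ of $dL=L\xi$ is holomorphic in $z$ on the universal cover of $\mathbb{C}\setminus\{0\}$ with $L(z,\cdot)\in\Lambda \mathrm{SL}_2\mathbb{C}_\sigma$ for each $z$. The isotropy group of $L$ relative to the dressing action is the set of all ($z$-independent) $h\in\Lambda \mathrm{SL}_2\mathbb{C}_\sigma$ for which there exists a possibly $z$-dependent function $W_+$ with values in $\Lambda_+\mathrm{SL}_2\mathbb{C}_\sigma$ such that $hL=LW_+$. *)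

theory Defs
  imports "HOL-Analysis.Analysis"
begin

text \<open>Continuous differentiability of order \<open>n\<close> on an \<^emph>\<open>open\<close> set, in the real sense:
  for a domain such as \<open>complex\<close> the directions \<open>v\<close> range over a two-dimensional real space.\<close>

primrec higher_differentiable_on ::
  "nat \<Rightarrow> 'a::real_normed_vector set \<Rightarrow> ('a \<Rightarrow> 'b::real_normed_vector) \<Rightarrow> bool" where
  "higher_differentiable_on 0 U f \<longleftrightarrow> continuous_on U f"
| "higher_differentiable_on (Suc n) U f \<longleftrightarrow>
     (\<forall>x\<in>U. f differentiable (at x)) \<and>
     (\<forall>v. higher_differentiable_on n U (\<lambda>x. frechet_derivative f (at x) v))"

text \<open>On a set that is not open (the unit circle, the closed unit disk), smoothness means being
  the restriction of a smooth function on an open neighbourhood.\<close>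

definition smooth_on ::
  "'a::real_normed_vector set \<Rightarrow> ('a \<Rightarrow> 'b::real_normed_vector) \<Rightarrow> bool" where
  "smooth_on S f \<longleftrightarrow>
     (\<exists>U g. open U \<and> S \<subseteq> U \<and> (\<forall>n. higher_differentiable_on n U g) \<and> (\<forall>x\<in>S. g x = f x))"

abbreviation unit_circle :: "complex set" where
  "unit_circle \<equiv> sphere 0 1"

text \<open>Loops are \<open>extensional\<close> functions, so that two loops are equal in HOL exactly when they agree
  on the unit circle. The loop parameter is written \<open>\<zeta>\<close>, since \<open>\<lambda>\<close> is reserved.\<close>

definition twisted_loops :: "(complex \<Rightarrow> complex^2^2) set" where
  "twisted_loops =
     {f \<in> extensional unit_circle.
        smooth_on unit_circle f \<and>
        (\<forall>\<zeta>\<in>unit_circle. det (f \<zeta>) = 1) \<and>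
        (\<forall>\<zeta>\<in>unit_circle. f (-\<zeta>) $ 1 $ 1 = f \<zeta> $ 1 $ 1 \<and> f (-\<zeta>) $ 2 $ 2 = f \<zeta> $ 2 $ 2) \<and>
        (\<forall>\<zeta>\<in>unit_circle. f (-\<zeta>) $ 1 $ 2 = - f \<zeta> $ 1 $ 2 \<and> f (-\<zeta>) $ 2 $ 1 = - f \<zeta> $ 2 $ 1)}"

definition twisted_loops_plus :: "(complex \<Rightarrow> complex^2^2) set" where
  "twisted_loops_plus =
     {f \<in> twisted_loops.
        \<exists>F. (\<forall>\<zeta>\<in>unit_circle. F \<zeta> = f \<zeta>) \<and>
            smooth_on (cball 0 1) F \<and>
            (\<forall>\<zeta>\<in>cball 0 1. det (F \<zeta>) = 1) \<and>
            (\<forall>i j. (\<lambda>\<zeta>. F \<zeta> $ i $ j) holomorphic_on ball 0 1)}"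

text \<open>The coefficient of \<open>dz\<close> in the potential \<open>\<xi>\<close>.\<close>

definition potential :: "complex \<Rightarrow> complex \<Rightarrow> complex \<Rightarrow> complex^2^2" where
  "potential c z \<zeta> = vector [vector [0, inverse \<zeta>], vector [inverse \<zeta> * (c * inverse z), 0]]"

text \<open>The universal cover of the punctured plane is realised as \<open>exp\<close> on \<open>complex\<close>
  (cf. \<open>covering_space_exp_punctured_plane\<close>). In the coordinate \<open>w\<close> of the cover, where
  \<open>z = exp w\<close> and \<open>dz = exp w dw\<close>, the equation \<open>dL = L \<xi>\<close> reads
  \<open>\<partial>L/\<partial>w = exp w \<cdot> L \<cdot> potential c (exp w) \<zeta>\<close>. The complex derivative is taken entrywise;
  its existence at every \<open>w\<close> includes the holomorphy of \<open>L\<close>.\<close>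

definition is_solution :: "complex \<Rightarrow> (complex \<Rightarrow> complex \<Rightarrow> complex^2^2) \<Rightarrow> bool" where
  "is_solution c L \<longleftrightarrow>
     (\<forall>w. L w \<in> twisted_loops) \<and>
     (\<forall>\<zeta>\<in>unit_circle. \<forall>w i j.
        ((\<lambda>w. L w \<zeta> $ i $ j) has_field_derivative
           exp w * (L w \<zeta> ** potential c (exp w) \<zeta>) $ i $ j) (at w))"

text \<open>\<open>W\<close> may depend on the point \<open>w\<close> of the universal cover, with no regularity required.\<close>

definition isotropy_group ::
  "(complex \<Rightarrow> complex \<Rightarrow> complex^2^2) \<Rightarrow> (complex \<Rightarrow> complex^2^2) set" where
  "isotropy_group L =
     {h \<in> twisted_loops.
        \<exists>W. (\<forall>w. W w \<in> twisted_loops_plus) \<and>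
            (\<forall>w. \<forall>\<zeta>\<in>unit_circle. h \<zeta> ** L w \<zeta> = L w \<zeta> ** W w \<zeta>)}"

end

theory Submission
  imports Defs "HOL-Complex_Analysis.Cauchy_Integral_Formula"
begin

text \<open>If \<open>h\<close> is in the isotropy group, then \<open>W = L\<^sup>-\<^sup>1 h L\<close> satisfies \<open>dW = [W, \<xi>]\<close> and extends
  holomorphically to the disk. Comparing Taylor coefficients at \<open>\<zeta> = 0\<close>, the traceless part of \<open>W\<close>
  is determined recursively up to constants: with \<open>z = exp w\<close>, each coefficient of the entries \<open>W\<^sub>1\<^sub>1 - W\<^sub>2\<^sub>2\<close> and
  \<open>W\<^sub>2\<^sub>1\<close> is \<open>exp (-w / 2)\<close> times a polynomial in \<open>exp (-w)\<close>. Hence the traceless part changes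
  sign under the deck transformation \<open>w \<mapsto> w + 2\<pi>\<i>\<close>, so the monodromy \<open>M\<close> of \<open>L\<close> anticommutes
  with the traceless part \<open>H\<close> of \<open>h\<close>. But \<open>M\<close> has determinant 1 and the eigenvalue 1, because the
  scalar equation has the single-valued solution \<open>\<Sum> x\<^sup>n / (n!)\<^sup>2\<close> with \<open>x = c z / \<zeta>\<^sup>2\<close>; thus
  \<open>tr M = 2 \<noteq> 0\<close>, which forces \<open>H = 0\<close>.\<close>

section \<open>Boundary moments of functions on the unit circle\<close>

text \<open>If \<open>f\<close> extends to a function \<open>F\<close> holomorphic in the disk and
  continuous up to the circle, the moment of index \<open>Suc n\<close> is 2 pi i times the Taylor
  coefficient of \<open>F\<close> at 0 of index \<open>n\<close>. Index 0 is kept as well: it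
  vanishes by Cauchy's theorem and starts the recursion below.\<close>

definition circle_moment :: "(complex \<Rightarrow> complex) \<Rightarrow> nat \<Rightarrow> complex" where
  "circle_moment f n = contour_integral (circlepath 0 1) (\<lambda>\<zeta>. f \<zeta> / \<zeta> ^ n)"

definition disc_extendable :: "(complex \<Rightarrow> complex) \<Rightarrow> bool" where
  "disc_extendable f \<longleftrightarrow>
     (\<exists>F. continuous_on (cball 0 1) F \<and> F holomorphic_on ball 0 1 \<and> (\<forall>\<zeta>\<in>unit_circle. F \<zeta> = f \<zeta>))"

lemma disc_extendable_add:
  "disc_extendable f \<Longrightarrow> disc_extendable g \<Longrightarrow> disc_extendable (\<lambda>\<zeta>. f \<zeta> + g \<zeta>)"
  unfolding disc_extendable_def
  apply (elim exE)
  subgoal for F G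
    by (rule exI[of _ "\<lambda>x. F x + G x"]) (auto intro!: continuous_intros holomorphic_intros)
  done

lemma disc_extendable_diff:
  "disc_extendable f \<Longrightarrow> disc_extendable g \<Longrightarrow> disc_extendable (\<lambda>\<zeta>. f \<zeta> - g \<zeta>)"
  unfolding disc_extendable_def
  apply (elim exE)
  subgoal for F G
    by (rule exI[of _ "\<lambda>x. F x - G x"]) (auto intro!: continuous_intros holomorphic_intros)
  done

lemma circle_moment_0:
  assumes "disc_extendable f"
  shows "circle_moment f 0 = 0"
proof -
  obtain F where F: "continuous_on (cball 0 1) F" "F holomorphic_on ball 0 1"
    "\<And>\<zeta>. \<zeta> \<in> unit_circle \<Longrightarrow> F \<zeta> = f \<zeta>"
    using assms unfolding disc_extendable_def by blast
  \<comment> \<open>Cauchy's formula at 0 is applied to \<open>u * F u\<close>, whose value there is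
    0; the extra factor cancels the denominator.\<close>
  have "contour_integral (circlepath 0 1) (\<lambda>u. u * F u / (u - 0) ^ Suc 0) = 0"
    by (subst Cauchy_contour_integral_circlepath)
       (auto intro!: continuous_intros holomorphic_intros F)
  also have "contour_integral (circlepath 0 1) (\<lambda>u. u * F u / (u - 0) ^ Suc 0) = circle_moment f 0"
    unfolding circle_moment_def by (rule contour_integral_eq) (use F(3) in auto)
  finally show ?thesis .
qed

text \<open>All Taylor coefficients of the extension at 0 vanish, so it is 0 in the open disk, and
  by continuity also on the boundary circle.\<close>

lemma circle_moments_eq_0D:
  assumes "disc_extendable f" "\<And>n. circle_moment f n = 0" "\<zeta> \<in> unit_circle"
  shows "f \<zeta> = 0"
proof -
  obtain F where F: "continuous_on (cball 0 1) F" "F holomorphic_on ball 0 1"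
    "\<And>\<zeta>. \<zeta> \<in> unit_circle \<Longrightarrow> F \<zeta> = f \<zeta>"
    using assms unfolding disc_extendable_def by blast
  have "(deriv ^^ n) F 0 = 0" for n
  proof -
    have "contour_integral (circlepath 0 1) (\<lambda>u. F u / (u - 0) ^ Suc n) = circle_moment f (Suc n)"
      unfolding circle_moment_def by (rule contour_integral_eq) (use F(3) in auto)
    then show ?thesis
      using Cauchy_higher_derivative_integral_circlepath(2)[OF F(1,2), of 0 n] assms(2) by simp
  qed
  then have "F x = 0" if "x \<in> ball 0 1" for x
    using holomorphic_fun_eq_0_on_ball[OF F(2) that] by simp
  moreover have "continuous_on (closure (ball 0 1)) F"
    using F(1) by simp
  moreover have "\<zeta> \<in> closure (ball 0 1)"
    using assms(3) by simp
  ultimately have "F \<zeta> = 0"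
    using continuous_constant_on_closure[of "ball 0 1" F 0 \<zeta>] by blast
  then show ?thesis
    using F(3) assms(3) by simp
qed

lemma circle_moment_linear:
  assumes "continuous_on unit_circle f" "continuous_on unit_circle g"
  shows "circle_moment (\<lambda>\<zeta>. a * f \<zeta> + b * g \<zeta>) n = a * circle_moment f n + b * circle_moment g n"
proof -
  have i: "(\<lambda>\<zeta>. k \<zeta> / \<zeta> ^ n) contour_integrable_on circlepath 0 1"
    if "continuous_on unit_circle k" for k
    by (intro contour_integrable_continuous_circlepath continuous_intros)
       (use that in auto)
  have "circle_moment (\<lambda>\<zeta>. a * f \<zeta> + b * g \<zeta>) n
    = contour_integral (circlepath 0 1) (\<lambda>\<zeta>. a * (f \<zeta> / \<zeta>^n) + b * (g \<zeta> / \<zeta>^n))"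
    unfolding circle_moment_def by (simp add: add_divide_distrib)
  also have "\<dots> = a * circle_moment f n + b * circle_moment g n"
    unfolding circle_moment_def
    by (simp add: contour_integral_add contour_integral_lmul contour_integrable_lmul i assms
        del: times_divide_eq_right)
  finally show ?thesis .
qed

lemma circle_moment_over:
  "circle_moment (\<lambda>\<zeta>. f \<zeta> / \<zeta>) n = circle_moment f (Suc n)"
  unfolding circle_moment_def by (rule contour_integral_eq) simp

text \<open>Differentiation under the integral sign. The Leibniz rule asks for joint continuity of
  the derivative, which is why joint continuity of solutions is established below.\<close>

lemma has_field_derivative_circle_moment:
  fixes f f' :: "complex \<Rightarrow> complex \<Rightarrow> complex"
  assumes der: "\<And>w \<zeta>. \<zeta> \<in> unit_circle \<Longrightarrow> ((\<lambda>w. f w \<zeta>) has_field_derivative f' w \<zeta>) (at w)"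
    and cf: "\<And>w. continuous_on unit_circle (f w)"
    and cf': "continuous_on (unit_circle \<times> UNIV) (\<lambda>(\<zeta>, w). f' w \<zeta>)"
  shows "((\<lambda>w. circle_moment (f w) n) has_field_derivative circle_moment (f' w) n) (at w)"
proof -
  define e where "e t = exp (2 * of_real pi * \<i> * of_real t)" for t
  \<comment> \<open>The weight is the velocity of the parametrisation \<open>e\<close> divided by
    \<open>e t ^ n\<close>, so a moment becomes an integral over the real interval from 0 to
    1.\<close>
  define k where "k t = 2 * pi * \<i> * e t / e t ^ n" for t
  have e: "e t \<in> unit_circle" for t
    by (simp add: e_def norm_exp)
  have e0: "e t \<noteq> 0" for t by (simp add: e_def)
  have ce: "continuous_on S e" for S
    unfolding e_def by (intro continuous_intros)
  have ck: "continuous_on S k" for S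
    unfolding k_def by (intro continuous_intros ce) (use e0 in auto)
  have eq: "circle_moment g n = integral (cbox 0 1) (\<lambda>t. g (e t) * k t)" for g
    unfolding circle_moment_def contour_integral_integral cbox_interval
    unfolding vector_derivative_circlepath unfolding circlepath e_def k_def
    by (intro integral_cong) (simp add: mult_ac)
  have "((\<lambda>w. integral (cbox 0 1) (\<lambda>t. f w (e t) * k t)) has_field_derivative
          integral (cbox 0 1) (\<lambda>t. f' w (e t) * k t)) (at w within UNIV)"
  proof (rule leibniz_rule_field_derivative[of UNIV])
    show "((\<lambda>x. f x (e t) * k t) has_field_derivative f' x (e t) * k t) (at x within UNIV)" for x t
      using DERIV_cmult_right[OF der[OF e]] by simp
    show "(\<lambda>t. f x (e t) * k t) integrable_on cbox 0 1" for x
      by (intro integrable_continuous continuous_intros ck continuous_on_compose2[OF cf ce])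
         (use e in auto)
    have "continuous_on (UNIV \<times> cbox 0 1) (\<lambda>p. (\<lambda>(\<zeta>, w). f' w \<zeta>) (e (snd p), fst p) * k (snd p))"
      by (intro continuous_intros continuous_on_compose2[OF cf'] continuous_on_compose2[OF ck[of UNIV]]
            continuous_on_compose2[OF ce[of UNIV]]) (use e in auto)
    then show "continuous_on (UNIV \<times> cbox 0 1) (\<lambda>(x, t). f' x (e t) * k t)"
      by (simp add: case_prod_unfold)
  qed auto
  then show ?thesis unfolding eq by simp
qed

section \<open>Growth and joint continuity of solutions of the linear system\<close>

lemma gronwall_unit_interval:
  fixes y y' :: "real \<Rightarrow> 'a::real_inner"
  assumes der: "\<And>t. t \<in> {0..1} \<Longrightarrow> (y has_vector_derivative y' t) (at t)"
    and bound: "\<And>t. t \<in> {0..1} \<Longrightarrow> norm (y' t) \<le> K * norm (y t)"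
  shows "norm (y 1) \<le> exp K * norm (y 0)"
proof -
  \<comment> \<open>By the Cauchy-Schwarz inequality the weight \<open>exp (- (2 * K * t))\<close>
    makes the squared norm of \<open>y\<close> nonincreasing.\<close>
  define g where "g t = (y t \<bullet> y t) * exp (- (2 * K * t))" for t
  have "g 1 \<le> g 0"
  proof (rule DERIV_nonpos_imp_nonincreasing[where f = g])
    fix t :: real assume t: "0 \<le> t" "t \<le> 1"
    have d: "(g has_real_derivative (2 * (y t \<bullet> y' t) - 2 * K * (y t \<bullet> y t)) * exp (- (2 * K * t))) (at t)"
      unfolding g_def has_field_derivative_def
      using der[of t, unfolded has_vector_derivative_def] t
      by (auto intro!: derivative_eq_intros simp: algebra_simps inner_commute fun_eq_iff)
    have "y t \<bullet> y' t \<le> norm (y t) * norm (y' t)"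
      by (rule norm_cauchy_schwarz)
    also have "\<dots> \<le> norm (y t) * (K * norm (y t))"
      using bound[of t] t by (intro mult_left_mono) auto
    also have "\<dots> = K * (y t \<bullet> y t)"
      by (simp add: dot_square_norm power2_eq_square)
    finally have "(2 * (y t \<bullet> y' t) - 2 * K * (y t \<bullet> y t)) * exp (- (2 * K * t)) \<le> 0"
      by (simp add: mult_nonpos_nonneg)
    then show "\<exists>z. (g has_real_derivative z) (at t) \<and> z \<le> 0"
      using d by blast
  qed simp
  then have "(norm (y 1))\<^sup>2 * exp (- (2 * K)) \<le> (norm (y 0))\<^sup>2"
    by (simp add: g_def dot_square_norm)
  then have "(norm (y 1))\<^sup>2 \<le> (norm (y 0))\<^sup>2 * exp (2 * K)"
    by (simp add: exp_minus field_simps)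
  also have "\<dots> = (exp K * norm (y 0))\<^sup>2"
    by (simp add: power_mult_distrib exp_double)
  finally show ?thesis
    by (rule power2_le_imp_le) simp
qed

text \<open>Each row of a solution satisfies this linear system. Gronwall's estimate along the
  segment from 0 to \<open>w\<close> gives a bound whose factor does not depend on \<zeta>, since
  \<open>inverse \<zeta>\<close> has norm 1.\<close>

lemma row_growth:
  fixes a b :: "complex \<Rightarrow> complex"
  assumes a: "\<And>w. (a has_field_derivative inverse \<zeta> * c * b w) (at w)"
    and b: "\<And>w. (b has_field_derivative inverse \<zeta> * exp w * a w) (at w)"
    and \<zeta>: "norm \<zeta> = 1" and w: "norm w \<le> R"
  shows "norm (a w, b w) \<le> exp (R * (norm c + exp R)) * norm (a 0, b 0)"
proof -
  define K where "K = norm w * (norm c + exp R)"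
  define y where "y t = (a (of_real t * w), b (of_real t * w))" for t :: real
  define y' where "y' t = (w * (inverse \<zeta> * c * b (of_real t * w)),
      w * (inverse \<zeta> * exp (of_real t * w) * a (of_real t * w)))" for t :: real
  have "norm (y 1) \<le> exp K * norm (y 0)"
  proof (rule gronwall_unit_interval)
    fix t :: real assume t: "t \<in> {0..1}"
    have l: "((\<lambda>t. of_real t * w) has_vector_derivative w) (at t)"
      by (auto intro!: derivative_eq_intros)
    show "(y has_vector_derivative y' t) (at t)"
      unfolding y_def y'_def
      by (intro has_vector_derivative_Pair)
        (use field_vector_diff_chain_at[OF l a] field_vector_diff_chain_at[OF l b] in \<open>simp_all add: o_def\<close>)
    have "norm (of_real t * w) \<le> R"
      using t w by (simp add: norm_mult) (metis mult_left_le_one_le norm_ge_zero order_trans)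
    then have e: "norm (exp (of_real t * w)) \<le> exp R"
      using norm_exp[of "of_real t * w"] by (meson exp_le_cancel_iff order_trans)
    let ?a = "norm (a (of_real t * w))" and ?b = "norm (b (of_real t * w))"
    have n1: "norm (w * (inverse \<zeta> * c * b (of_real t * w))) \<le> K * ?b"
      using \<zeta> by (simp add: norm_mult norm_inverse K_def mult_right_mono mult_left_mono algebra_simps)
    have n2: "norm (w * (inverse \<zeta> * exp (of_real t * w) * a (of_real t * w))) \<le> K * ?a"
    proof -
      have "norm (exp (of_real t * w)) * ?a \<le> (norm c + exp R) * ?a"
        using e by (intro mult_right_mono) (auto intro: add_increasing)
      then show ?thesis
        using \<zeta> by (simp add: norm_mult norm_inverse K_def mult.assoc mult_left_mono)
    qed
    have "norm (y' t) \<le> sqrt ((K * ?b)\<^sup>2 + (K * ?a)\<^sup>2)"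
      unfolding y'_def norm_Pair by (intro real_sqrt_le_mono add_mono power_mono n1 n2) auto
    also have "\<dots> = sqrt (K\<^sup>2 * (?a\<^sup>2 + ?b\<^sup>2))"
      by (simp add: power_mult_distrib algebra_simps)
    also have "\<dots> = K * norm (y t)"
      by (simp add: real_sqrt_mult y_def norm_Pair K_def)
    finally show "norm (y' t) \<le> K * norm (y t)" .
  qed
  also have "\<dots> \<le> exp (R * (norm c + exp R)) * norm (y 0)"
    unfolding K_def using w by (intro mult_right_mono) (auto intro!: mult_right_mono simp: add_nonneg_pos less_imp_le)
  finally show ?thesis
    by (simp add: y_def)
qed

text \<open>Only separate regularity is given: holomorphy in \<open>w\<close> and continuity in
  \<zeta>. The growth bound makes the derivatives in \<open>w\<close> bounded uniformly in \<zeta>,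
  hence the functions locally Lipschitz in \<open>w\<close> uniformly in \<zeta>; with continuity in
  \<zeta> this yields joint continuity.\<close>

lemma row_jointly_continuous:
  fixes a b :: "complex \<Rightarrow> complex \<Rightarrow> complex"
  assumes a: "\<And>w \<zeta>. \<zeta> \<in> unit_circle \<Longrightarrow>
        ((\<lambda>w. a w \<zeta>) has_field_derivative inverse \<zeta> * c * b w \<zeta>) (at w)"
    and b: "\<And>w \<zeta>. \<zeta> \<in> unit_circle \<Longrightarrow>
        ((\<lambda>w. b w \<zeta>) has_field_derivative inverse \<zeta> * exp w * a w \<zeta>) (at w)"
    and ca: "\<And>w. continuous_on unit_circle (a w)" and cb: "\<And>w. continuous_on unit_circle (b w)"
  shows "continuous_on (unit_circle \<times> UNIV) (\<lambda>(\<zeta>, w). a w \<zeta>)"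
    and "continuous_on (unit_circle \<times> UNIV) (\<lambda>(\<zeta>, w). b w \<zeta>)"
proof -
  \<comment> \<open>Compactness of the circle bounds the initial values at \<open>w = 0\<close> by
    one constant \<open>N\<close>.\<close>
  have "compact ((\<lambda>\<zeta>. norm (a 0 \<zeta>, b 0 \<zeta>)) ` unit_circle)"
    by (intro compact_continuous_image continuous_intros ca cb compact_sphere)
  then have "bdd_above ((\<lambda>\<zeta>. norm (a 0 \<zeta>, b 0 \<zeta>)) ` unit_circle)"
    by (rule bounded_imp_bdd_above[OF compact_imp_bounded])
  then obtain N where N: "\<And>\<zeta>. \<zeta> \<in> unit_circle \<Longrightarrow> norm (a 0 \<zeta>, b 0 \<zeta>) \<le> N"
    unfolding bdd_above_def by blast
  have lip: "\<exists>u>0. \<exists>L. \<forall>\<zeta>\<in>cball t u \<inter> unit_circle.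
      L-lipschitz_on (cball x u \<inter> UNIV) (\<lambda>w. a w \<zeta>) \<and> L-lipschitz_on (cball x u \<inter> UNIV) (\<lambda>w. b w \<zeta>)"
    for t x :: complex
  proof -
    define R where "R = norm x + 1"
    define B where "B = exp (R * (norm c + exp R)) * N"
    have B: "norm (a w \<zeta>) \<le> B" "norm (b w \<zeta>) \<le> B" "norm w \<le> R"
      if "w \<in> cball x 1" "\<zeta> \<in> unit_circle" for w \<zeta>
    proof -
      have "norm w = norm (x - (x - w))" by simp
      also have "\<dots> \<le> norm x + norm (x - w)" by (rule norm_triangle_ineq4)
      finally show w: "norm w \<le> R"
        using that by (simp add: R_def dist_norm)
      have "norm (a w \<zeta>, b w \<zeta>) \<le> exp (R * (norm c + exp R)) * norm (a 0 \<zeta>, b 0 \<zeta>)"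
        using a b that w by (intro row_growth) auto
      also have "\<dots> \<le> B"
        unfolding B_def using N that by (intro mult_left_mono) auto
      finally have "norm (a w \<zeta>, b w \<zeta>) \<le> B" .
      then show "norm (a w \<zeta>) \<le> B" "norm (b w \<zeta>) \<le> B"
        using norm_fst_le[of "a w \<zeta>" "b w \<zeta>"] norm_snd_le[of "b w \<zeta>" "a w \<zeta>"] by linarith+
    qed
    \<comment> \<open>This bounds both derivatives on the ball around \<open>x\<close>, so it serves
      as common Lipschitz constant.\<close>
    define K where "K = (norm c + exp R) * B"
    have K: "K-lipschitz_on (cball x 1) (\<lambda>w. a w \<zeta>) \<and> K-lipschitz_on (cball x 1) (\<lambda>w. b w \<zeta>)"
      if \<zeta>: "\<zeta> \<in> unit_circle" for \<zeta>
    proof -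
      have B0: "0 \<le> B"
        using B(1)[of x \<zeta>] \<zeta> by (meson centre_in_cball norm_ge_zero order_trans zero_le_one)
      have K0: "0 \<le> K"
        unfolding K_def using B0 by (intro mult_nonneg_nonneg add_nonneg_nonneg) auto
      have 1: "norm (inverse \<zeta> * c * b w \<zeta>) \<le> K" if "w \<in> cball x 1" for w
        using \<zeta> B(2)[OF that \<zeta>] unfolding K_def
        by (auto simp: norm_mult norm_inverse intro!: mult_mono)
      have 2: "norm (inverse \<zeta> * exp w * a w \<zeta>) \<le> K" if "w \<in> cball x 1" for w
      proof -
        have "norm (exp w) \<le> exp R"
          using norm_exp[of w] B(3)[OF that \<zeta>] by (meson exp_le_cancel_iff order_trans)
        then show ?thesis
          using \<zeta> B(1)[OF that \<zeta>] unfolding K_def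
          by (auto simp: norm_mult norm_inverse intro!: mult_mono add_increasing)
      qed
      have da: "dist (a u \<zeta>) (a v \<zeta>) \<le> K * dist u v" if "u \<in> cball x 1" "v \<in> cball x 1" for u v
        using field_differentiable_bound[of "cball x 1" "\<lambda>w. a w \<zeta>" "\<lambda>w. inverse \<zeta> * c * b w \<zeta>" K u v]
          a[OF \<zeta>] 1 that by (auto simp: dist_norm intro: DERIV_subset)
      have db: "dist (b u \<zeta>) (b v \<zeta>) \<le> K * dist u v" if "u \<in> cball x 1" "v \<in> cball x 1" for u v
        using field_differentiable_bound[of "cball x 1" "\<lambda>w. b w \<zeta>" "\<lambda>w. inverse \<zeta> * exp w * a w \<zeta>" K u v]
          b[OF \<zeta>] 2 that by (auto simp: dist_norm intro: DERIV_subset)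
      show ?thesis
        by (intro conjI lipschitz_onI da db K0)
    qed
    then show ?thesis
      by (intro exI[of _ 1] conjI exI[of _ K]) auto
  qed
  have "local_lipschitz unit_circle UNIV (\<lambda>\<zeta> w. a w \<zeta>)"
    and "local_lipschitz unit_circle UNIV (\<lambda>\<zeta> w. b w \<zeta>)"
    by (rule local_lipschitzI; use lip in meson)+
  from this[THEN continuous_on_TimesI]
  show "continuous_on (unit_circle \<times> UNIV) (\<lambda>(\<zeta>, w). a w \<zeta>)"
    and "continuous_on (unit_circle \<times> UNIV) (\<lambda>(\<zeta>, w). b w \<zeta>)"
    using ca cb by simp_all
qed

section \<open>The moment recursion and its antiperiodic solutions\<close>

text \<open>In terms of \<open>z = exp w\<close> these are the polynomials in \<open>1 / z\<close>
  times a branch of \<open>z\<close> to the power -1/2. The class is closed under differentiation,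
  and the half-integer power gives the sign change under the deck transformation.\<close>

definition half_exp_poly :: "(complex \<Rightarrow> complex) \<Rightarrow> bool" where
  "half_exp_poly f \<longleftrightarrow> (\<exists>p. \<forall>w. f w = exp (- w / 2) * poly p (exp (- w)))"

lemma half_exp_poly_zero: "half_exp_poly (\<lambda>w. 0)"
  unfolding half_exp_poly_def by (rule exI[of _ 0]) simp

lemma half_exp_poly_cmult_iff:
  assumes "k \<noteq> 0"
  shows "half_exp_poly (\<lambda>w. k * f w) \<longleftrightarrow> half_exp_poly f"
proof -
  have *: "half_exp_poly (\<lambda>w. k * f w)" if h: "half_exp_poly f" for k f
  proof -
    obtain p where "\<And>w. f w = exp (- w / 2) * poly p (exp (- w))"
      using h unfolding half_exp_poly_def by blast
    then show ?thesis
      unfolding half_exp_poly_def by (intro exI[of _ "smult k p"]) simp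
  qed
  show ?thesis
    using *[of f k] *[of "\<lambda>w. k * f w" "inverse k"] assms by (auto simp: field_simps)
qed

lemma half_exp_poly_antiperiodic:
  assumes "half_exp_poly f"
  shows "f (w + 2 * of_real pi * \<i>) = - f w"
proof -
  obtain p where p: "\<And>w. f w = exp (- w / 2) * poly p (exp (- w))"
    using assms unfolding half_exp_poly_def by blast
  have 1: "exp (- (w + 2 * of_real pi * \<i>)) = exp (- w)"
    by (simp add: exp_add exp_diff exp_minus algebra_simps)
  have "- (w + 2 * of_real pi * \<i>) / 2 = - w / 2 - of_real pi * \<i>"
    by (simp add: field_simps)
  then have 2: "exp (- (w + 2 * of_real pi * \<i>) / 2) = - exp (- w / 2)"
    by (simp only: exp_diff exp_pi_i) simp
  show ?thesis
    unfolding p 1 2 by simp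
qed

lemma half_exp_poly_deriv:
  assumes "half_exp_poly f" and der: "\<And>w. (f has_field_derivative f' w) (at w)"
  shows "half_exp_poly f'"
proof -
  obtain p where p: "\<And>w. f w = exp (- w / 2) * poly p (exp (- w))"
    using assms unfolding half_exp_poly_def by blast
  then have f: "f = (\<lambda>w. exp (- w / 2) * poly p (exp (- w)))"
    by blast
  \<comment> \<open>With \<open>x = exp (- w)\<close>, the chain rule turns \<open>p\<close> into
    \<open>- p / 2 - x * p'\<close>; \<open>pCons 0\<close> is multiplication by
    \<open>x\<close>.\<close>
  have "(f has_field_derivative
      exp (- w / 2) * poly (smult (- 1 / 2) p - pCons 0 (pderiv p)) (exp (- w))) (at w)" for w
    unfolding f by (rule derivative_eq_intros refl | simp)+ (simp add: algebra_simps)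
  then show ?thesis
    unfolding half_exp_poly_def using DERIV_unique[OF der] by blast
qed

lemma pderiv_surj:
  fixes p :: "'a::field_char_0 poly"
  obtains q where "pderiv q = p"
proof
  show "pderiv (\<Sum>i\<le>degree p. monom (coeff p i / of_nat (Suc i)) (Suc i)) = p"
    by (subst higher_pderiv_sum[of 1, simplified])
       (simp add: pderiv_monom poly_as_sum_of_monoms del: of_nat_Suc)
qed

text \<open>Since \<open>exp (-w) * d w\<close> has no component along \<open>exp (-w / 2)\<close>, which solves
  the homogeneous equation, no resonant term \<open>w * exp (-w / 2)\<close> arises.\<close>

lemma half_exp_poly_solution:
  assumes "half_exp_poly d"
    and der: "\<And>w. (f has_field_derivative f' w) (at w)"
    and ode: "\<And>w. 2 * f' w + f w = exp (- w) * d w"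
  shows "half_exp_poly f"
proof -
  obtain p where p: "\<And>w. d w = exp (- w / 2) * poly p (exp (- w))"
    using assms unfolding half_exp_poly_def by blast
  obtain q where q: "pderiv q = p"
    by (rule pderiv_surj)
  \<comment> \<open>The integrating factor \<open>exp (w / 2)\<close> turns the equation into
    \<open>(exp (w / 2) * f)' = exp (- w) * p (exp (- w)) / 2\<close>, and the right side is the
    derivative of \<open>- q (exp (- w)) / 2\<close>. So \<open>g\<close> is constant.\<close>
  define g where "g w = exp (w / 2) * f w + poly q (exp (- w)) / 2" for w
  have "(g has_field_derivative 0) (at w within UNIV)" for w
  proof -
    have "(g has_field_derivative
        exp (w / 2) * (2 * f' w + f w) / 2 - exp (- w) * poly p (exp (- w)) / 2) (at w)"
      unfolding g_def
      by (rule derivative_eq_intros refl der | simp)+ (simp add: q algebra_simps)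
    moreover have "exp (w / 2) * exp (- (w / 2)) = 1"
      by (simp flip: exp_add)
    then have "exp (w / 2) * (2 * f' w + f w) = exp (- w) * poly p (exp (- w))"
      unfolding ode p by (simp add: algebra_simps)
    ultimately show ?thesis
      by simp
  qed
  then obtain k where k: "\<And>w. g w = k"
    using has_field_derivative_zero_constant[of UNIV g] by auto
  have "f w = exp (- w / 2) * poly ([:k:] - smult (1 / 2) q) (exp (- w))" for w
  proof -
    have "f w = exp (- w / 2) * (exp (w / 2) * f w)"
      by (simp flip: exp_add mult.assoc)
    also have "exp (w / 2) * f w = k - poly q (exp (- w)) / 2"
      using k[of w] by (simp add: g_def algebra_simps)
    finally show ?thesis
      by simp
  qed
  then show ?thesis
    unfolding half_exp_poly_def by blast
qed

text \<open>\<open>A\<close>, \<open>B\<close>, \<open>C\<close> stand for the moments of the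
  entries \<open>W\<^sub>1\<^sub>1 - W\<^sub>2\<^sub>2\<close>, \<open>W\<^sub>1\<^sub>2\<close>,
  \<open>W\<^sub>2\<^sub>1\<close>. The induction carries only \<open>A\<close> and
  \<open>C\<close>: solving for \<open>B\<close> brings in \<open>exp w * C\<close>, which may leave
  the class \<open>half_exp_poly\<close>.\<close>

lemma moment_recursion_antiperiodic:
  fixes A B C :: "nat \<Rightarrow> complex \<Rightarrow> complex"
  assumes c: "c \<noteq> 0"
    and A: "\<And>n w. (A n has_field_derivative 2 * (c * B (Suc n) w - exp w * C (Suc n) w)) (at w)"
    and B: "\<And>n w. (B n has_field_derivative exp w * A (Suc n) w) (at w)"
    and C: "\<And>n w. (C n has_field_derivative - c * A (Suc n) w) (at w)"
    and zero: "\<And>w. A 0 w = 0" "\<And>w. B 0 w = 0" "\<And>w. C 0 w = 0"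
  shows "A n (w + 2 * of_real pi * \<i>) = - A n w"
    and "B n (w + 2 * of_real pi * \<i>) = - B n w"
    and "C n (w + 2 * of_real pi * \<i>) = - C n w"
proof -
  have C_A: "half_exp_poly (A (Suc n))" if "half_exp_poly (C n)" for n
    using half_exp_poly_deriv[OF that C] c half_exp_poly_cmult_iff[of "- c" "A (Suc n)"] by simp
  have A_BC: "half_exp_poly (\<lambda>w. c * B (Suc n) w - exp w * C (Suc n) w)" if "half_exp_poly (A n)" for n
    using half_exp_poly_deriv[OF that A] by (subst (asm) half_exp_poly_cmult_iff) simp_all
  have "half_exp_poly (A n) \<and> half_exp_poly (C n)" for n
  proof (induction n)
    case 0
    have "A 0 = (\<lambda>w. 0)" and "C 0 = (\<lambda>w. 0)"
      using zero by auto
    then show ?case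
      by (simp add: half_exp_poly_zero)
  next
    case (Suc n)
    \<comment> \<open>A second derivative of \<open>A n\<close> eliminates \<open>B\<close>.
      Replacing \<open>c * A (Suc (Suc n))\<close> by minus the derivative of
      \<open>C (Suc n)\<close> leaves a first-order equation
      \<open>2 * C' + C = exp (- w) * d\<close> for \<open>C (Suc n)\<close> alone, with
      \<open>d\<close> in the class.\<close>
    have "((\<lambda>w. c * B (Suc n) w - exp w * C (Suc n) w) has_field_derivative
        exp w * (2 * c * A (Suc (Suc n)) w - C (Suc n) w)) (at w)" for w
      by (rule derivative_eq_intros refl B C | simp)+ (simp add: algebra_simps)
    from half_exp_poly_deriv[OF A_BC this]
    have "half_exp_poly (\<lambda>w. - 1 * (exp w * (2 * c * A (Suc (Suc n)) w - C (Suc n) w)))"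
      using Suc by (subst half_exp_poly_cmult_iff) auto
    then have "half_exp_poly (C (Suc n))"
      using C by (rule half_exp_poly_solution) (simp add: exp_minus field_simps)
    then show ?case
      using C_A Suc by blast
  qed
  then have h: "half_exp_poly (A n)" "half_exp_poly (C n)" for n
    by blast+
  then have AC: "A n (w + 2 * of_real pi * \<i>) = - A n w" "C n (w + 2 * of_real pi * \<i>) = - C n w" for n
    by (simp_all only: half_exp_poly_antiperiodic)
  show "A n (w + 2 * of_real pi * \<i>) = - A n w" "C n (w + 2 * of_real pi * \<i>) = - C n w"
    by (fact AC)+
  show "B n (w + 2 * of_real pi * \<i>) = - B n w"
  proof (cases n)
    case 0
    then show ?thesis
      using zero by simp
  next
    case (Suc m)
    \<comment> \<open>The combination \<open>c * B n - exp w * C n\<close> is in the class for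
      \<open>n > 0\<close>, being half the derivative of \<open>A m\<close>. As it and
      \<open>C n\<close> are antiperiodic and \<open>exp w\<close> is periodic, \<open>B n\<close>
      is antiperiodic because \<open>c\<close> is nonzero.\<close>
    have "c * B n (w + 2 * of_real pi * \<i>) - exp w * (- C n w) = - (c * B n w - exp w * C n w)"
      using half_exp_poly_antiperiodic[OF A_BC[OF h(1)], of m w] by (simp add: Suc exp_add AC(2))
    then have "c * B n (w + 2 * of_real pi * \<i>) = c * - B n w"
      by algebra
    then show ?thesis
      by (simp only: mult_left_cancel[OF c])
  qed
qed

section \<open>A single-valued solution and the trace of the monodromy\<close>

text \<open>The function \<open>f\<close> is the modified Bessel function of order 0 at twice the
  square root of \<open>x\<close>, an entire solution of \<open>(x * f')' = f\<close>. The companion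
  \<open>g = x * f'\<close> puts the equation into first-order form.\<close>

lemma bessel_solution:
  obtains f g :: "complex \<Rightarrow> complex" and f' where "f 0 = 1"
    "\<And>x. (f has_field_derivative f' x) (at x)" "\<And>x. x * f' x = g x"
    "\<And>x. (g has_field_derivative f x) (at x)"
proof
  define s :: "nat \<Rightarrow> complex" where "s n = 1 / (fact n)\<^sup>2" for n
  define f where "f x = (\<Sum>n. s n * x ^ n)" for x
  define f' where "f' x = (\<Sum>n. diffs s n * x ^ n)" for x
  have s: "summable (\<lambda>n. s n * x ^ n)" for x
  proof (rule summable_comparison_test)
    have "norm (s n * x ^ n) \<le> inverse (fact n) * norm x ^ n" for n
    proof -
      have "inverse ((fact n)\<^sup>2) \<le> (inverse (fact n) :: real)"
        by (intro le_imp_inverse_le) (auto simp: power2_eq_square fact_ge_1)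
      then show ?thesis
        by (auto simp: s_def norm_mult norm_divide norm_power norm_inverse divide_inverse intro!: mult_right_mono)
    qed
    then show "\<exists>N. \<forall>n\<ge>N. norm (s n * x ^ n) \<le> inverse (fact n) * norm x ^ n"
      by blast
    show "summable (\<lambda>n. inverse (fact n) * norm x ^ n)"
      by (rule summable_exp)
  qed
  show "f 0 = 1"
    using powser_zero[of s] by (simp add: f_def) (simp add: s_def)
  show "(f has_field_derivative f' x) (at x)" for x
    unfolding f_def f'_def by (rule termdiffs_strong_converges_everywhere[OF s])
  have "summable (\<lambda>n. diffs s n * x ^ n)" for x
    using termdiff_converges_all[OF s] .
  then have d: "(\<lambda>n. of_nat n * s n * x ^ (n - Suc 0)) sums f' x" for x
    unfolding f'_def by (rule diffs_equiv)
  have g: "(\<lambda>n. of_nat n * s n * x ^ n) sums (x * f' x)" for x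
  proof -
    have "x * (of_nat n * s n * x ^ (n - Suc 0)) = of_nat n * s n * x ^ n" for n
      by (cases n) auto
    then show ?thesis
      using sums_mult[OF d, of x x] by (simp only:)
  qed
  show "x * f' x = (\<Sum>n. of_nat n * s n * x ^ n)" for x
    using g sums_unique by blast
  \<comment> \<open>The identity \<open>(n + 1)^2 * s (n + 1) = s n\<close> is the differential
    equation at the level of coefficients.\<close>
  have "diffs (\<lambda>n. of_nat n * s n) = s"
    by (auto simp: diffs_def s_def fact_Suc power2_eq_square field_simps fun_eq_iff simp del: of_nat_Suc)
  then show "((\<lambda>x. \<Sum>n. of_nat n * s n * x ^ n) has_field_derivative f x) (at x)" for x
    using termdiffs_strong_converges_everywhere[of "\<lambda>n. of_nat n * s n" x] g
    by (auto simp: f_def sums_iff)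
qed

text \<open>Let \<open>L\<close> and \<open>L'\<close> have rows \<open>(a, b)\<close>,
  \<open>(d, e)\<close> and their primed versions, let \<open>N\<close> be the inverse of
  \<open>L\<close> times \<open>L'\<close>, and let \<open>X\<close> be the traceless part of
  \<open>h\<close> conjugated by \<open>L\<close>. The hypotheses say that conjugation by
  \<open>N\<close> negates \<open>X\<close>, so \<open>X\<close> and \<open>N\<close> anticommute;
  for traceless \<open>X\<close> this forces \<open>tr N * X = 0\<close>. Since
  \<open>det N = 1\<close> and \<open>det (N - 1) = 0\<close>, the trace is 2.\<close>

lemma trace_2_anticommute:
  fixes a b d e a' b' d' e' h1 h2 h3 h4 :: "'a::field_char_0"
  assumes det: "a * e - b * d = 1" "a' * e' - b' * d' = 1"
    and unipotent: "(a' - a) * (e' - e) - (b' - b) * (d' - d) = 0"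
    and p: "e' * (h1 * a' + h2 * d') - b' * (h3 * a' + h4 * d')
        - (a' * (h3 * b' + h4 * e') - d' * (h1 * b' + h2 * e'))
      = - (e * (h1 * a + h2 * d) - b * (h3 * a + h4 * d)
        - (a * (h3 * b + h4 * e) - d * (h1 * b + h2 * e)))"
    and q: "e' * (h1 * b' + h2 * e') - b' * (h3 * b' + h4 * e')
      = - (e * (h1 * b + h2 * e) - b * (h3 * b + h4 * e))"
    and s: "a' * (h3 * a' + h4 * d') - d' * (h1 * a' + h2 * d')
      = - (a * (h3 * a + h4 * d) - d * (h1 * a + h2 * d))"
  shows "h1 = h4" "h2 = 0" "h3 = 0"
proof -
  define P where "P = e * (h1 * a + h2 * d) - b * (h3 * a + h4 * d)
        - (a * (h3 * b + h4 * e) - d * (h1 * b + h2 * e))"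
  define Q where "Q = e * (h1 * b + h2 * e) - b * (h3 * b + h4 * e)"
  define S where "S = a * (h3 * a + h4 * d) - d * (h1 * a + h2 * d)"
  define H where "H = h1 - h4"
  have tr: "e * a' - b * d' + (a * e' - d * b') = 2"
    using det unipotent by (simp add: algebra_simps)
  \<comment> \<open>With \<open>X\<close> the matrix with rows \<open>(P/2, Q)\<close> and
    \<open>(S, -P/2)\<close>, these are the entries of twice the identity
    \<open>H0 * L = L * X\<close>, where \<open>H0\<close> is the traceless part of
    \<open>h\<close>. The primed version has \<open>- X\<close> instead.\<close>
  have L: "H * a + 2 * h2 * d = a * P + 2 * b * S" "H * b + 2 * h2 * e = 2 * a * Q - b * P"
    "2 * h3 * a - H * d = d * P + 2 * e * S" "2 * h3 * b - H * e = 2 * d * Q - e * P"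
    using det(1) unfolding P_def Q_def S_def H_def by algebra+
  have L': "H * a' + 2 * h2 * d' = - (a' * P + 2 * b' * S)" "H * b' + 2 * h2 * e' = - (2 * a' * Q - b' * P)"
    "2 * h3 * a' - H * d' = - (d' * P + 2 * e' * S)" "2 * h3 * b' - H * e' = - (2 * d' * Q - e' * P)"
    using det(2) p[folded P_def] q[folded Q_def] s[folded S_def] unfolding H_def by algebra+
  define n1 n2 n3 n4 where "n1 = e * a' - b * d'" and "n2 = e * b' - b * e'"
    and "n3 = a * d' - d * a'" and "n4 = a * e' - d * b'"
  note n_defs = n1_def n2_def n3_def n4_def
  \<comment> \<open>The four entries of \<open>X * N + N * X = 0\<close>; the two diagonal ones
    subtract to \<open>P * tr N = 0\<close>.\<close>
  have "P * n1 + Q * n3 + n2 * S = 0" "- P * n4 + S * n2 + n3 * Q = 0"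
    "Q * (n1 + n4) = 0" "S * (n1 + n4) = 0"
    using L L' det(1) unfolding n_defs by algebra+
  moreover from this have "P * (n1 + n4) = 0"
    by algebra
  ultimately have PQS: "P = 0" "Q = 0" "S = 0"
    using tr unfolding n_defs by auto
  have "H = 0" "2 * h2 = 0" "2 * h3 = 0"
    using L det(1) unfolding PQS by algebra+
  then show "h1 = h4" "h2 = 0" "h3 = 0"
    by (simp_all add: H_def)
qed

text \<open>The periodic solution \<open>(y, z)\<close> of the same system has constant Wronskian
  with each row, so the increment of each row over one period is proportional to
  \<open>(y, z)\<close> wherever \<open>y\<close> is nonzero. The two increments are then linearly
  dependent.\<close>

lemma unipotent_monodromy:
  fixes a b d e :: "complex \<Rightarrow> complex"
  assumes c: "c \<noteq> 0" and \<zeta>: "\<zeta> \<noteq> 0"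
    and a: "\<And>w. (a has_field_derivative inverse \<zeta> * c * b w) (at w)"
    and b: "\<And>w. (b has_field_derivative inverse \<zeta> * exp w * a w) (at w)"
    and d: "\<And>w. (d has_field_derivative inverse \<zeta> * c * e w) (at w)"
    and e: "\<And>w. (e has_field_derivative inverse \<zeta> * exp w * d w) (at w)"
  obtains w w' where "w' = w + 2 * of_real pi * \<i>"
    "(a w' - a w) * (e w' - e w) - (b w' - b w) * (d w' - d w) = 0"
proof -
  obtain f g f' :: "complex \<Rightarrow> complex" where f0: "f 0 = 1"
    and f: "\<And>x. (f has_field_derivative f' x) (at x)" and g': "\<And>x. x * f' x = g x"
    and g: "\<And>x. (g has_field_derivative f x) (at x)"
    using bessel_solution by metis
  \<comment> \<open>Substituting \<open>x = k * exp w\<close> in the Bessel equation gives the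
    scalar equation for \<open>y\<close>; the factor in \<open>z\<close> is forced by the first
    equation of the system.\<close>
  define k where "k = c / \<zeta>\<^sup>2"
  define y z where "y w = f (k * exp w)" and "z w = \<zeta> / c * g (k * exp w)" for w
  have kexp: "((\<lambda>w. k * exp w) has_field_derivative k * exp w) (at w)" for w
    by (auto intro!: derivative_eq_intros)
  have y: "(y has_field_derivative inverse \<zeta> * c * z w) (at w)" for w
  proof -
    have "inverse \<zeta> * c * z w = f' (k * exp w) * (k * exp w)"
      using c \<zeta> g'[of "k * exp w"] by (simp add: z_def mult_ac(2))
    then show ?thesis
      using DERIV_chain2[OF f kexp, of w] by (simp add: y_def[abs_def])
  qed
  have z: "(z has_field_derivative inverse \<zeta> * exp w * y w) (at w)" for w
    using DERIV_cmult[OF DERIV_chain2[OF g kexp, of w], of "\<zeta> / c"] c \<zeta>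
    by (simp add: y_def z_def[abs_def] k_def field_simps power2_eq_square)
  have "((\<lambda>w. y w * e w - z w * d w) has_field_derivative 0) (at w within UNIV)" for w
    by (rule derivative_eq_intros refl y z d e | simp)+
  then obtain r where r: "\<And>w. y w * e w - z w * d w = r"
    using has_field_derivative_zero_constant[of UNIV "\<lambda>w. y w * e w - z w * d w"] by auto
  have "((\<lambda>w. y w * b w - z w * a w) has_field_derivative 0) (at w within UNIV)" for w
    by (rule derivative_eq_intros refl y z a b | simp)+
  then obtain s where s: "\<And>w. y w * b w - z w * a w = s"
    using has_field_derivative_zero_constant[of UNIV "\<lambda>w. y w * b w - z w * a w"] by auto
  \<comment> \<open>A point with \<open>y w\<close> nonzero: \<open>f\<close> is nonzero near 0, and
    a nonzero \<open>x\<close> there has the form \<open>k * exp w\<close>.\<close>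
  have "isCont f 0"
    using f by (rule DERIV_isCont)
  then have "\<forall>\<^sub>F x in at 0. f x \<noteq> 0"
    using f0 by (auto simp: isCont_def intro: tendsto_imp_eventually_ne)
  moreover have "\<forall>\<^sub>F x in at 0. x \<noteq> (0::complex)"
    by (simp add: eventually_at_filter)
  ultimately have "\<forall>\<^sub>F x in at 0. f x \<noteq> 0 \<and> x \<noteq> 0"
    by eventually_elim simp
  then obtain x where x: "f x \<noteq> 0" "x \<noteq> 0"
    using eventually_happens by fastforce
  define w where "w = Ln (x / k)"
  have "k \<noteq> 0"
    using c \<zeta> by (simp add: k_def)
  then have yw: "y w \<noteq> 0"
    using x by (simp add: y_def w_def)
  define w' where "w' = w + 2 * of_real pi * \<i>"
  have "exp w' = exp w"
    by (simp add: w'_def exp_add)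
  then have "y w' = y w" "z w' = z w"
    by (simp_all add: y_def z_def)
  then have "y w * (e w' - e w) = z w * (d w' - d w)" "y w * (b w' - b w) = z w * (a w' - a w)"
    using r[of w] r[of w'] s[of w] s[of w'] by (simp_all add: algebra_simps)
  then have "y w * ((a w' - a w) * (e w' - e w) - (b w' - b w) * (d w' - d w)) = 0"
    by algebra
  then show thesis
    using yw that[OF w'_def] by simp
qed

section \<open>Antiperiodic solutions of the commutator equation\<close>

text \<open>The equations are those of \<open>dW = [W, \<xi>]\<close> for the traceless part of
  \<open>W\<close>. Taking moments turns division by \<zeta> into an index shift, which gives the
  recursion above; extendability makes the moments of index 0 vanish.\<close>

lemma commutator_ode_antiperiodic:
  fixes \<alpha> \<beta> \<gamma> :: "complex \<Rightarrow> complex \<Rightarrow> complex"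
  assumes c: "c \<noteq> 0"
    and \<alpha>: "\<And>w \<zeta>. \<zeta> \<in> unit_circle \<Longrightarrow> ((\<lambda>w. \<alpha> w \<zeta>) has_field_derivative
        (2 * c * \<beta> w \<zeta> + - 2 * exp w * \<gamma> w \<zeta>) / \<zeta>) (at w)"
    and \<beta>: "\<And>w \<zeta>. \<zeta> \<in> unit_circle \<Longrightarrow> ((\<lambda>w. \<beta> w \<zeta>) has_field_derivative exp w * \<alpha> w \<zeta> / \<zeta>) (at w)"
    and \<gamma>: "\<And>w \<zeta>. \<zeta> \<in> unit_circle \<Longrightarrow> ((\<lambda>w. \<gamma> w \<zeta>) has_field_derivative - c * \<alpha> w \<zeta> / \<zeta>) (at w)"
    and cont: "continuous_on (unit_circle \<times> UNIV) (\<lambda>(\<zeta>, w). \<alpha> w \<zeta>)"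
      "continuous_on (unit_circle \<times> UNIV) (\<lambda>(\<zeta>, w). \<beta> w \<zeta>)"
      "continuous_on (unit_circle \<times> UNIV) (\<lambda>(\<zeta>, w). \<gamma> w \<zeta>)"
    and ext: "\<And>w. disc_extendable (\<alpha> w)" "\<And>w. disc_extendable (\<beta> w)" "\<And>w. disc_extendable (\<gamma> w)"
    and \<zeta>: "\<zeta> \<in> unit_circle" and w': "w' = w + 2 * of_real pi * \<i>"
  shows "\<alpha> w' \<zeta> = - \<alpha> w \<zeta>" "\<beta> w' \<zeta> = - \<beta> w \<zeta>" "\<gamma> w' \<zeta> = - \<gamma> w \<zeta>"
proof -
  have slice: "continuous_on unit_circle (f w)"
    if "continuous_on (unit_circle \<times> UNIV) (\<lambda>(\<zeta>, w). f w \<zeta>)" for f :: "complex \<Rightarrow> complex \<Rightarrow> complex" and w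
  proof -
    have "continuous_on unit_circle (\<lambda>\<zeta>. (\<zeta>, w))"
      by (intro continuous_intros)
    from continuous_on_compose2[OF that this] show ?thesis
      by auto
  qed
  note slices = cont[THEN slice]
  note joint = cont[unfolded case_prod_unfold]
  have lin: "circle_moment (\<lambda>\<zeta>. k * \<alpha> w \<zeta>) n = k * circle_moment (\<alpha> w) n" for k w n
    using circle_moment_linear[OF slices(1) slices(1), of k w 0 w n] by simp
  have A: "((\<lambda>w. circle_moment (\<alpha> w) n) has_field_derivative
      2 * (c * circle_moment (\<beta> w) (Suc n) - exp w * circle_moment (\<gamma> w) (Suc n))) (at w)" for n w
  proof -
    have "continuous_on (unit_circle \<times> UNIV)
        (\<lambda>(\<zeta>, w). (2 * c * \<beta> w \<zeta> + - 2 * exp w * \<gamma> w \<zeta>) / \<zeta>)"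
      unfolding case_prod_unfold by (intro continuous_intros joint) auto
    from has_field_derivative_circle_moment[OF \<alpha> slices(1) this, of n w]
    show ?thesis
      by (simp only: circle_moment_over circle_moment_linear[OF slices(2,3)]) (simp add: algebra_simps)
  qed
  have B: "((\<lambda>w. circle_moment (\<beta> w) n) has_field_derivative exp w * circle_moment (\<alpha> w) (Suc n)) (at w)" for n w
  proof -
    have "continuous_on (unit_circle \<times> UNIV) (\<lambda>(\<zeta>, w). exp w * \<alpha> w \<zeta> / \<zeta>)"
      unfolding case_prod_unfold by (intro continuous_intros joint) auto
    from has_field_derivative_circle_moment[OF \<beta> slices(2) this, of n w]
    show ?thesis
      by (simp only: circle_moment_over lin)
  qed
  have C: "((\<lambda>w. circle_moment (\<gamma> w) n) has_field_derivative - c * circle_moment (\<alpha> w) (Suc n)) (at w)" for n w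
  proof -
    have "continuous_on (unit_circle \<times> UNIV) (\<lambda>(\<zeta>, w). - c * \<alpha> w \<zeta> / \<zeta>)"
      unfolding case_prod_unfold by (intro continuous_intros joint) auto
    from has_field_derivative_circle_moment[OF \<gamma> slices(3) this, of n w]
    show ?thesis
      by (simp only: circle_moment_over lin)
  qed
  note anti = moment_recursion_antiperiodic[OF c A B C ext[THEN circle_moment_0], of w, folded w']
  have *: "f w' \<zeta> = - f w \<zeta>"
    if "continuous_on (unit_circle \<times> UNIV) (\<lambda>(\<zeta>, w). f w \<zeta>)" "\<And>w. disc_extendable (f w)"
      "\<And>n. circle_moment (f w') n = - circle_moment (f w) n" for f
  proof -
    \<comment> \<open>Antiperiodicity passes from the moments to the functions because an extendable
      function is determined on the circle by its moments.\<close>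
    have "disc_extendable (\<lambda>\<zeta>. f w' \<zeta> + f w \<zeta>)"
      by (intro disc_extendable_add that)
    moreover have "circle_moment (\<lambda>\<zeta>. f w' \<zeta> + f w \<zeta>) n = 0" for n
      using circle_moment_linear[OF slice[OF that(1)] slice[OF that(1)], of 1 w' 1 w n] that(3)[of n] by simp
    ultimately have "f w' \<zeta> + f w \<zeta> = 0"
      using \<zeta> by (rule circle_moments_eq_0D)
    then show ?thesis
      by (simp add: eq_neg_iff_add_eq_0)
  qed
  show "\<alpha> w' \<zeta> = - \<alpha> w \<zeta>" "\<beta> w' \<zeta> = - \<beta> w \<zeta>" "\<gamma> w' \<zeta> = - \<gamma> w \<zeta>"
    by (rule *[OF cont(1) ext(1) anti(1)] *[OF cont(2) ext(2) anti(2)] *[OF cont(3) ext(3) anti(3)])+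
qed

section \<open>Twisted loops and the isotropy group\<close>

lemma smooth_on_imp_continuous_on: "smooth_on S f \<Longrightarrow> continuous_on S f"
  unfolding smooth_on_def
  by (metis continuous_on_cong continuous_on_subset higher_differentiable_on.simps(1))

lemma smooth_on_const: "smooth_on S (\<lambda>_. k)"
proof -
  have "higher_differentiable_on n UNIV (\<lambda>_. k)" for n k
    by (induction n arbitrary: k) auto
  then show ?thesis
    unfolding smooth_on_def by (intro exI[of _ UNIV] exI[of _ "\<lambda>_. k"]) auto
qed

lemma twisted_loops_continuous:
  assumes "f \<in> twisted_loops"
  shows "continuous_on unit_circle (\<lambda>\<zeta>. f \<zeta> $ i $ j)"
  using assms unfolding twisted_loops_def
  by (auto intro!: continuous_intros dest: smooth_on_imp_continuous_on)

lemma twisted_loops_det: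
  assumes "f \<in> twisted_loops" "\<zeta> \<in> unit_circle"
  shows "f \<zeta> $ 1 $ 1 * f \<zeta> $ 2 $ 2 - f \<zeta> $ 1 $ 2 * f \<zeta> $ 2 $ 1 = 1"
  using assms unfolding twisted_loops_def by (auto simp: det_2)

lemma twisted_loops_plus_disc_extendable:
  assumes "f \<in> twisted_loops_plus"
  shows "disc_extendable (\<lambda>\<zeta>. f \<zeta> $ i $ j)"
proof -
  obtain F where F: "\<And>\<zeta>. \<zeta> \<in> unit_circle \<Longrightarrow> F \<zeta> = f \<zeta>" "smooth_on (cball 0 1) F"
    "\<And>i j. (\<lambda>\<zeta>. F \<zeta> $ i $ j) holomorphic_on ball 0 1"
    using assms unfolding twisted_loops_plus_def by blast
  show ?thesis
    unfolding disc_extendable_def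
    by (intro exI[of _ "\<lambda>\<zeta>. F \<zeta> $ i $ j"] conjI F(3) continuous_intros smooth_on_imp_continuous_on F(2))
       (simp add: F(1))
qed

text \<open>The factor \<open>exp w\<close> coming from \<open>dz\<close> cancels the pole
  \<open>inverse z\<close> of the potential, leaving a system with coefficients entire in
  \<open>w\<close>.\<close>

lemma is_solution_entries:
  assumes "is_solution c L" "\<zeta> \<in> unit_circle"
  shows "((\<lambda>w. L w \<zeta> $ i $ 1) has_field_derivative inverse \<zeta> * c * L w \<zeta> $ i $ 2) (at w)"
    and "((\<lambda>w. L w \<zeta> $ i $ 2) has_field_derivative inverse \<zeta> * exp w * L w \<zeta> $ i $ 1) (at w)"
proof -
  have "((\<lambda>w. L w \<zeta> $ i $ j) has_field_derivative exp w * (L w \<zeta> ** potential c (exp w) \<zeta>) $ i $ j) (at w)"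
    for j
    using assms unfolding is_solution_def by blast
  from this[of 1] this[of 2]
  have "((\<lambda>w. L w \<zeta> $ i $ 1) has_field_derivative
        exp w * (inverse (exp w) * (inverse \<zeta> * c * L w \<zeta> $ i $ 2))) (at w)"
    and "((\<lambda>w. L w \<zeta> $ i $ 2) has_field_derivative inverse \<zeta> * exp w * L w \<zeta> $ i $ 1) (at w)"
    by (simp_all add: matrix_matrix_mult_def potential_def sum_2 mult_ac)
  moreover have "exp w * (inverse (exp w) * x) = x" for x
    by simp
  ultimately show "((\<lambda>w. L w \<zeta> $ i $ 1) has_field_derivative inverse \<zeta> * c * L w \<zeta> $ i $ 2) (at w)"
    and "((\<lambda>w. L w \<zeta> $ i $ 2) has_field_derivative inverse \<zeta> * exp w * L w \<zeta> $ i $ 1) (at w)"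
    by simp_all
qed

lemma isotropy_group_scalar:
  assumes c: "c \<noteq> 0" and L: "is_solution c L" and h: "h \<in> isotropy_group L" and \<zeta>: "\<zeta> \<in> unit_circle"
  shows "h \<zeta> $ 1 $ 1 = h \<zeta> $ 2 $ 2" "h \<zeta> $ 1 $ 2 = 0" "h \<zeta> $ 2 $ 1 = 0"
proof -
  obtain W where hl: "h \<in> twisted_loops" and W: "\<And>w. W w \<in> twisted_loops_plus"
    "\<And>w \<zeta>. \<zeta> \<in> unit_circle \<Longrightarrow> h \<zeta> ** L w \<zeta> = L w \<zeta> ** W w \<zeta>"
    using h unfolding isotropy_group_def by blast
  have Ll: "L w \<in> twisted_loops" for w
    using L unfolding is_solution_def by blast
  define a b d e where "a w \<zeta> = L w \<zeta> $ 1 $ 1" and "b w \<zeta> = L w \<zeta> $ 1 $ 2"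
    and "d w \<zeta> = L w \<zeta> $ 2 $ 1" and "e w \<zeta> = L w \<zeta> $ 2 $ 2" for w \<zeta>
  note L_defs = a_def b_def d_def e_def
  define h1 h2 h3 h4 where "h1 \<zeta> = h \<zeta> $ 1 $ 1" and "h2 \<zeta> = h \<zeta> $ 1 $ 2"
    and "h3 \<zeta> = h \<zeta> $ 2 $ 1" and "h4 \<zeta> = h \<zeta> $ 2 $ 2" for \<zeta>
  note h_defs = h1_def h2_def h3_def h4_def
  have det: "a w \<zeta> * e w \<zeta> - b w \<zeta> * d w \<zeta> = 1" if "\<zeta> \<in> unit_circle" for w \<zeta>
    unfolding L_defs using twisted_loops_det[OF Ll that] .
  have da: "((\<lambda>w. a w \<zeta>) has_field_derivative inverse \<zeta> * c * b w \<zeta>) (at w)"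
    and db: "((\<lambda>w. b w \<zeta>) has_field_derivative inverse \<zeta> * exp w * a w \<zeta>) (at w)"
    and dd: "((\<lambda>w. d w \<zeta>) has_field_derivative inverse \<zeta> * c * e w \<zeta>) (at w)"
    and de: "((\<lambda>w. e w \<zeta>) has_field_derivative inverse \<zeta> * exp w * d w \<zeta>) (at w)"
    if "\<zeta> \<in> unit_circle" for w \<zeta>
    unfolding L_defs using is_solution_entries[OF L that] by blast+
  have cont: "continuous_on unit_circle (a w)" "continuous_on unit_circle (b w)"
    "continuous_on unit_circle (d w)" "continuous_on unit_circle (e w)" for w
    unfolding L_defs[abs_def] by (intro twisted_loops_continuous Ll)+
  have "continuous_on unit_circle h1" "continuous_on unit_circle h2"
    "continuous_on unit_circle h3" "continuous_on unit_circle h4"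
    unfolding h_defs[abs_def] by (intro twisted_loops_continuous hl)+
  from this[THEN continuous_on_compose2, OF continuous_on_fst[OF continuous_on_id], of "unit_circle \<times> UNIV"]
  have ch: "continuous_on (unit_circle \<times> UNIV) (\<lambda>p. h1 (fst p))"
    "continuous_on (unit_circle \<times> UNIV) (\<lambda>p. h2 (fst p))"
    "continuous_on (unit_circle \<times> UNIV) (\<lambda>p. h3 (fst p))"
    "continuous_on (unit_circle \<times> UNIV) (\<lambda>p. h4 (fst p))"
    by auto
  note joint = row_jointly_continuous[OF da db cont(1,2), unfolded case_prod_unfold]
    row_jointly_continuous[OF dd de cont(3,4), unfolded case_prod_unfold] ch
  \<comment> \<open>These are the entries of the adjugate of \<open>L\<close> times
    \<open>h * L\<close>. As \<open>det L = 1\<close>, they agree with \<open>W\<close> on the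
    circle, and they make the dependence on \<open>w\<close> explicit enough to
    differentiate.\<close>
  define W1 W2 W3 W4 where
      "W1 w \<zeta> = e w \<zeta> * (h1 \<zeta> * a w \<zeta> + h2 \<zeta> * d w \<zeta>) - b w \<zeta> * (h3 \<zeta> * a w \<zeta> + h4 \<zeta> * d w \<zeta>)"
    and "W2 w \<zeta> = e w \<zeta> * (h1 \<zeta> * b w \<zeta> + h2 \<zeta> * e w \<zeta>) - b w \<zeta> * (h3 \<zeta> * b w \<zeta> + h4 \<zeta> * e w \<zeta>)"
    and "W3 w \<zeta> = a w \<zeta> * (h3 \<zeta> * a w \<zeta> + h4 \<zeta> * d w \<zeta>) - d w \<zeta> * (h1 \<zeta> * a w \<zeta> + h2 \<zeta> * d w \<zeta>)"
    and "W4 w \<zeta> = a w \<zeta> * (h3 \<zeta> * b w \<zeta> + h4 \<zeta> * e w \<zeta>) - d w \<zeta> * (h1 \<zeta> * b w \<zeta> + h2 \<zeta> * e w \<zeta>)"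
    for w \<zeta>
  note W_defs = W1_def W2_def W3_def W4_def
  have W_eq: "W w \<zeta> $ 1 $ 1 = W1 w \<zeta>" "W w \<zeta> $ 1 $ 2 = W2 w \<zeta>"
    "W w \<zeta> $ 2 $ 1 = W3 w \<zeta>" "W w \<zeta> $ 2 $ 2 = W4 w \<zeta>" if \<zeta>: "\<zeta> \<in> unit_circle" for w \<zeta>
  proof -
    have "(h \<zeta> ** L w \<zeta>) $ i $ j = (L w \<zeta> ** W w \<zeta>) $ i $ j" for i j
      by (simp only: W(2)[OF \<zeta>])
    from this[of 1 1] this[of 1 2] this[of 2 1] this[of 2 2]
    have "h1 \<zeta> * a w \<zeta> + h2 \<zeta> * d w \<zeta> = a w \<zeta> * W w \<zeta> $ 1 $ 1 + b w \<zeta> * W w \<zeta> $ 2 $ 1"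
      "h1 \<zeta> * b w \<zeta> + h2 \<zeta> * e w \<zeta> = a w \<zeta> * W w \<zeta> $ 1 $ 2 + b w \<zeta> * W w \<zeta> $ 2 $ 2"
      "h3 \<zeta> * a w \<zeta> + h4 \<zeta> * d w \<zeta> = d w \<zeta> * W w \<zeta> $ 1 $ 1 + e w \<zeta> * W w \<zeta> $ 2 $ 1"
      "h3 \<zeta> * b w \<zeta> + h4 \<zeta> * e w \<zeta> = d w \<zeta> * W w \<zeta> $ 1 $ 2 + e w \<zeta> * W w \<zeta> $ 2 $ 2"
      by (simp_all add: matrix_matrix_mult_def sum_2 L_defs h_defs)
    with det[OF \<zeta>, of w] show "W w \<zeta> $ 1 $ 1 = W1 w \<zeta>" "W w \<zeta> $ 1 $ 2 = W2 w \<zeta>"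
      "W w \<zeta> $ 2 $ 1 = W3 w \<zeta>" "W w \<zeta> $ 2 $ 2 = W4 w \<zeta>"
      unfolding W_defs by algebra+
  qed
  have ext: "disc_extendable (W2 w)" "disc_extendable (W3 w)" "disc_extendable (\<lambda>\<zeta>. W1 w \<zeta> - W4 w \<zeta>)" for w
  proof -
    have *: "disc_extendable f" if "disc_extendable g" "\<And>\<zeta>. \<zeta> \<in> unit_circle \<Longrightarrow> g \<zeta> = f \<zeta>" for f g
      using that unfolding disc_extendable_def by metis
    note ex = twisted_loops_plus_disc_extendable[OF W(1)]
    show "disc_extendable (W2 w)"
      by (rule *[OF ex W_eq(2)])
    show "disc_extendable (W3 w)"
      by (rule *[OF ex W_eq(3)])
    show "disc_extendable (\<lambda>\<zeta>. W1 w \<zeta> - W4 w \<zeta>)"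
      by (rule *[OF disc_extendable_diff[OF ex[of w 1 1] ex[of w 2 2]]]) (simp only: W_eq)
  qed
  obtain w w' where w': "w' = w + 2 * of_real pi * \<i>"
    and unip: "(a w' \<zeta> - a w \<zeta>) * (e w' \<zeta> - e w \<zeta>) - (b w' \<zeta> - b w \<zeta>) * (d w' \<zeta> - d w \<zeta>) = 0"
    using unipotent_monodromy[OF c _ da db dd de] \<zeta> by (metis norm_zero mem_sphere_0 zero_neq_one)
  note anti = commutator_ode_antiperiodic[where \<alpha> = "\<lambda>w \<zeta>. W1 w \<zeta> - W4 w \<zeta>" and \<beta> = W2 and \<gamma> = W3,
      OF c _ _ _ _ _ _ ext(3,1,2) \<zeta> w']
  \<comment> \<open>The commutator equation for \<open>L\<^sup>-\<^sup>1 h L\<close>, with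
    \<open>h\<close> constant in \<open>w\<close>, read off from the row equations.\<close>
  have dW: "((\<lambda>w. W1 w \<zeta> - W4 w \<zeta>) has_field_derivative (2 * c * W2 w \<zeta> + - 2 * exp w * W3 w \<zeta>) / \<zeta>) (at w)"
    "((\<lambda>w. W2 w \<zeta>) has_field_derivative exp w * (W1 w \<zeta> - W4 w \<zeta>) / \<zeta>) (at w)"
    "((\<lambda>w. W3 w \<zeta>) has_field_derivative - c * (W1 w \<zeta> - W4 w \<zeta>) / \<zeta>) (at w)"
    if "\<zeta> \<in> unit_circle" for w \<zeta>
    unfolding W_defs
    by ((rule derivative_eq_intros refl da[OF that] db[OF that] dd[OF that] de[OF that])+,
        simp only: divide_inverse, algebra)+
  have cW: "continuous_on (unit_circle \<times> UNIV) (\<lambda>(\<zeta>, w). W1 w \<zeta> - W4 w \<zeta>)"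
    "continuous_on (unit_circle \<times> UNIV) (\<lambda>(\<zeta>, w). W2 w \<zeta>)"
    "continuous_on (unit_circle \<times> UNIV) (\<lambda>(\<zeta>, w). W3 w \<zeta>)"
    unfolding W_defs case_prod_unfold by (auto intro!: continuous_intros joint)
  have "W1 w' \<zeta> - W4 w' \<zeta> = - (W1 w \<zeta> - W4 w \<zeta>)" "W2 w' \<zeta> = - W2 w \<zeta>" "W3 w' \<zeta> = - W3 w \<zeta>"
    using commutator_ode_antiperiodic[OF c dW cW ext(3,1,2) \<zeta> w'] by blast+
  from trace_2_anticommute[OF det[OF \<zeta>] det[OF \<zeta>] unip this[unfolded W_defs]]
  show "h \<zeta> $ 1 $ 1 = h \<zeta> $ 2 $ 2" "h \<zeta> $ 1 $ 2 = 0" "h \<zeta> $ 2 $ 1 = 0"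
    unfolding h_defs by blast+
qed

text \<open>Determinant 1 makes the diagonal entry a square root of 1 at each point; by continuity
  on the connected circle its sign is constant.\<close>

lemma scalar_twisted_loop:
  assumes h: "h \<in> twisted_loops"
    and scalar: "\<And>\<zeta>. \<zeta> \<in> unit_circle \<Longrightarrow> h \<zeta> $ 1 $ 1 = h \<zeta> $ 2 $ 2 \<and> h \<zeta> $ 1 $ 2 = 0 \<and> h \<zeta> $ 2 $ 1 = 0"
  shows "h \<in> {restrict (\<lambda>_. mat 1) unit_circle, restrict (\<lambda>_. - mat 1) unit_circle}"
proof -
  have sq: "h \<zeta> $ 1 $ 1 \<in> {1, - 1}" if "\<zeta> \<in> unit_circle" for \<zeta>
  proof -
    have "(h \<zeta> $ 1 $ 1)\<^sup>2 = 1"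
      using twisted_loops_det[OF h that] scalar[OF that] by (simp add: power2_eq_square)
    then show ?thesis
      by (simp add: power2_eq_1_iff)
  qed
  have "(\<lambda>\<zeta>. h \<zeta> $ 1 $ 1) constant_on unit_circle"
  proof (rule continuous_finite_range_constant)
    show "connected unit_circle"
      by (rule connected_sphere) simp
    show "continuous_on unit_circle (\<lambda>\<zeta>. h \<zeta> $ 1 $ 1)"
      by (rule twisted_loops_continuous[OF h])
    show "finite ((\<lambda>\<zeta>. h \<zeta> $ 1 $ 1) ` unit_circle)"
      by (rule finite_subset[of _ "{1, - 1}"]) (intro image_subsetI sq, simp_all)
  qed
  then obtain k where k: "\<And>\<zeta>. \<zeta> \<in> unit_circle \<Longrightarrow> h \<zeta> $ 1 $ 1 = k"
    unfolding constant_on_def by blast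
  have "k = 1 \<or> k = - 1"
    using sq[of 1] k[of 1] by simp
  moreover have "h = restrict (\<lambda>_. mat k) unit_circle"
  proof
    fix \<zeta>
    show "h \<zeta> = restrict (\<lambda>_. mat k) unit_circle \<zeta>"
    proof (cases "\<zeta> \<in> unit_circle")
      case True
      then show ?thesis
        using k[OF True] scalar[OF True] by (simp add: vec_eq_iff forall_2 mat_def)
    next
      case False
      moreover have "h \<in> extensional unit_circle"
        using h unfolding twisted_loops_def by blast
      ultimately show ?thesis
        by (simp add: extensional_def restrict_def)
    qed
  qed
  moreover have "mat (- 1) = (- mat 1 :: complex^2^2)"
    by (simp add: mat_def vec_eq_iff)
  ultimately show ?thesis
    by auto
qed

lemma const_in_twisted_loops_plus:
  assumes "k\<^sup>2 = 1"
  shows "restrict (\<lambda>_. mat k) unit_circle \<in> twisted_loops_plus"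
proof -
  have "smooth_on unit_circle (restrict (\<lambda>_. mat k :: complex^2^2) unit_circle)"
    using smooth_on_const[of unit_circle "mat k :: complex^2^2"] unfolding smooth_on_def by simp
  then have "restrict (\<lambda>_. mat k) unit_circle \<in> twisted_loops"
    unfolding twisted_loops_def using assms by (simp add: det_2 mat_def power2_eq_square)
  then show ?thesis
    unfolding twisted_loops_plus_def using assms
    by (auto intro!: exI[of _ "\<lambda>_. mat k"] smooth_on_const simp: det_2 mat_def power2_eq_square)
qed

theorem theorem3p1:
  fixes c :: complex
    and L :: "complex \<Rightarrow> complex \<Rightarrow> complex^2^2"
  assumes "c \<noteq> 0"
    and "is_solution c L"
  shows "isotropy_group L =
    {restrict (\<lambda>_. mat 1) unit_circle, restrict (\<lambda>_. - mat 1) unit_circle}"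
proof
  show "isotropy_group L \<subseteq>
      {restrict (\<lambda>_. mat 1) unit_circle, restrict (\<lambda>_. - mat 1) unit_circle}"
  proof
    fix h assume h: "h \<in> isotropy_group L"
    then have "h \<in> twisted_loops"
      unfolding isotropy_group_def by blast
    then show "h \<in> {restrict (\<lambda>_. mat 1) unit_circle, restrict (\<lambda>_. - mat 1) unit_circle}"
      using isotropy_group_scalar[OF assms h] by (intro scalar_twisted_loop conjI)
  qed
  \<comment> \<open>Scalar matrices commute with \<open>L\<close>, so \<open>W\<close> can be taken
    to be the constant loop itself.\<close>
  have "restrict (\<lambda>_. mat k) unit_circle \<in> isotropy_group L" if "k\<^sup>2 = 1" for k
  proof -
    have comm: "mat k ** M = M ** mat k" for M :: "complex^2^2"
      by (simp add: vec_eq_iff forall_2 matrix_matrix_mult_def mat_def sum_2)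
    have "restrict (\<lambda>_. mat k) unit_circle \<in> twisted_loops"
      using const_in_twisted_loops_plus[OF that] unfolding twisted_loops_plus_def by blast
    then show ?thesis
      unfolding isotropy_group_def
      using const_in_twisted_loops_plus[OF that] comm
      by (intro CollectI conjI exI[of _ "\<lambda>_. restrict (\<lambda>_. mat k) unit_circle"]) simp_all
  qed
  from this[of 1] this[of "- 1"]
  have "restrict (\<lambda>_. mat 1) unit_circle \<in> isotropy_group L"
    "restrict (\<lambda>_. mat (- 1)) unit_circle \<in> isotropy_group L"
    by simp_all
  moreover have "mat (- 1) = (- mat 1 :: complex^2^2)"
    by (simp add: mat_def vec_eq_iff)
  ultimately show "{restrict (\<lambda>_. mat 1) unit_circle, restrict (\<lambda>_. - mat 1) unit_circle}
      \<subseteq> isotropy_group L"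
    by simp
qed

end
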